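(* Let $n\ge1$, let $\alpha\in\mathcal{T}_n$ be an idempotent of rank $l>2$, and consider the variant $(\mathcal{T}_n,* )$ with $\beta*\gamma=\beta\alpha\gamma$. Then: (1) The set of completely isolated subsemigroups is $$\mathfrak{CI}(\mathcal{T}_n,* )=\{\mathcal{T}_n,\mathcal{T}_n^{(l)},\mathcal{T}_n\setminus\mathcal{T}_n^{(l)}\}\cup\{F(X,\mathcal{Y}),\,F(X,\mathcal{Y})\cup(\mathcal{T}_n\setminus\mathcal{T}_n^{(l)}): X\subseteq\mathcal{X},\,X\ne\varnothing,\mathcal{X}\}\cup\{F(\mathcal{X},Y),\,F(\mathcal{X},Y)\cup(\mathcal{T}_n\setminus\mathcal{T}_n^{(l)}): Y\subseteq\mathcal{Y},\,Y\ne\varnothing,\mathcal{Y}\}.$$ (2) The set of right convex subsemigroups is $\mathfrak{RC}(\mathcal{T}_n,* )=\{\mathcal{T}_n\}\cup\{F(\mathcal{X},Y): Y\subseteq\mathcal{Y},\,Y\neq\varnothing\}$. (3) The set of left convex subsemigroups is $\mathfrak{LC}(\mathcal{T}_n,* )=\{\mathcal{T}_n\}\cup\{F(X,\mathcal{Y}): X\subseteq\mathcal{X},\,X\neq\varnothing\}$. (4) The set of convex subsemigroups is $\mathfrak{C}(\mathcal{T}_n,* )=\{\mathcal{T}_n,\mathcal{T}_n^{(l)}\}$.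
   Context: Subsemigroups are non-empty. A subsemigroup $T$ of a semigroup $S$ is: completely isolated if $xy\in T$ implies $x\in T$ or $y\in T$; right convex if $xy\in T$ implies $y\in T$; left convex if $xy\in T$ implies $x\in T$; convex if $xy\in T$ implies $x\in T$ and $y\in T$ (for all $x,y\in S$). $N=\{1,\dots,n\}$; $\mathcal{T}_n$ is the set of all maps $N\to N$, composed from left to right: $(\beta\gamma)(x)=\gamma(\beta(x))$. $\operatorname{im}(\beta)$ is the image of $\beta$, $\operatorname{rank}(\beta)=|\operatorname{im}(\beta)|$, and $\Lambda_\beta$ is the kernel of $\beta$: the equivalence relation (partition of $N$) $x\,\Lambda_\beta\, y\iff\beta(x)=\beta(y)$. $\alpha\in\mathcal{T}_n$ is an idempotent ($\alpha\alpha=\alpha$) of rank $l$ with kernel blocks $A_1,\dots,A_l$ and image $A=\{a_1,\dots,a_l\}$, where $\alpha(A_i)=\{a_i\}$, so $a_i\in A_i$. The variant $(\mathcal{T}_n,* )$ has operation $\beta*\gamma=\beta\alpha\gamma$; all idempotents and powers are taken with respect to $*$. For an idempotent $\varepsilon$ of $(\mathcal{T}_n,* )$, $\sqrt{\varepsilon}$ is the set of all $\beta$ some $*$-power of which equals $\varepsilon$. For $\beta\in\mathcal{T}_n$ let $\varepsilon$ be the unique idempotent in the cyclic subsemigroup of $(\mathcal{T}_n,* )$ generated by $\beta$; the stable rank of $\beta$ is $\operatorname{rank}(\varepsilon)$. It is at most $l$. $\mathcal{T}_n^{(l)}$ is the set of elements of stable rank $l$. $\mathcal{X}$ is the set of all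 partitions of $N$ into $l$ blocks such that $a_1,\dots,a_l$ lie in different blocks. $\mathcal{Y}$ is the set of all sets $\{b_1,\dots,b_l\}$ with $b_i\in A_i$ for all $i$. For non-empty $X\subseteq\mathcal{X}$ and $Y\subseteq\mathcal{Y}$, $F(X,Y)$ is the union of all $\sqrt{\varepsilon}$ where $\varepsilon$ is an idempotent of $(\mathcal{T}_n,* )$ of rank $l$ with $\Lambda_\varepsilon\in X$ and $\operatorname{im}(\varepsilon)\in Y$. *)

theory Defs
  imports Main "HOL-Library.FuncSet" "HOL-Library.Disjoint_Sets"
begin

text \<open>
  A semigroup is given by a carrier \<open>S\<close> and an operation \<open>f\<close> whose values outside \<open>S\<close> are irrelevant.
\<close>

definition subsemigroup :: "'a set \<Rightarrow> ('a \<Rightarrow> 'a \<Rightarrow> 'a) \<Rightarrow> 'a set \<Rightarrow> bool" where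
  "subsemigroup S f T \<longleftrightarrow> T \<subseteq> S \<and> T \<noteq> {} \<and> (\<forall>x\<in>T. \<forall>y\<in>T. f x y \<in> T)"

definition completely_isolated :: "'a set \<Rightarrow> ('a \<Rightarrow> 'a \<Rightarrow> 'a) \<Rightarrow> 'a set \<Rightarrow> bool" where
  "completely_isolated S f T \<longleftrightarrow>
     subsemigroup S f T \<and> (\<forall>x\<in>S. \<forall>y\<in>S. f x y \<in> T \<longrightarrow> x \<in> T \<or> y \<in> T)"

definition right_convex :: "'a set \<Rightarrow> ('a \<Rightarrow> 'a \<Rightarrow> 'a) \<Rightarrow> 'a set \<Rightarrow> bool" where
  "right_convex S f T \<longleftrightarrow>
     subsemigroup S f T \<and> (\<forall>x\<in>S. \<forall>y\<in>S. f x y \<in> T \<longrightarrow> y \<in> T)"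

definition left_convex :: "'a set \<Rightarrow> ('a \<Rightarrow> 'a \<Rightarrow> 'a) \<Rightarrow> 'a set \<Rightarrow> bool" where
  "left_convex S f T \<longleftrightarrow>
     subsemigroup S f T \<and> (\<forall>x\<in>S. \<forall>y\<in>S. f x y \<in> T \<longrightarrow> x \<in> T)"

definition convex_subsemigroup :: "'a set \<Rightarrow> ('a \<Rightarrow> 'a \<Rightarrow> 'a) \<Rightarrow> 'a set \<Rightarrow> bool" where
  "convex_subsemigroup S f T \<longleftrightarrow>
     subsemigroup S f T \<and> (\<forall>x\<in>S. \<forall>y\<in>S. f x y \<in> T \<longrightarrow> x \<in> T \<and> y \<in> T)"

definition is_idempotent :: "('a \<Rightarrow> 'a \<Rightarrow> 'a) \<Rightarrow> 'a \<Rightarrow> bool" where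
  "is_idempotent f e \<longleftrightarrow> f e e = e"

text \<open>There is no unit in general, so the exponent is shifted: \<open>power_Suc f x k\<close> is the power \<open>x^(k+1)\<close>.\<close>

primrec power_Suc :: "('a \<Rightarrow> 'a \<Rightarrow> 'a) \<Rightarrow> 'a \<Rightarrow> nat \<Rightarrow> 'a" where
  "power_Suc f x 0 = x"
| "power_Suc f x (Suc k) = f (power_Suc f x k) x"

definition cyclic_subsemigroup :: "('a \<Rightarrow> 'a \<Rightarrow> 'a) \<Rightarrow> 'a \<Rightarrow> 'a set" where
  "cyclic_subsemigroup f x = range (power_Suc f x)"

definition maps :: "nat \<Rightarrow> (nat \<Rightarrow> nat) set" where
  "maps n = {1..n} \<rightarrow>\<^sub>E {1..n}"

text \<open>Maps are composed from left to right, whereas \<^const>\<open>compose\<close> applies its last argument first.\<close>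

definition comp_lr :: "nat \<Rightarrow> (nat \<Rightarrow> nat) \<Rightarrow> (nat \<Rightarrow> nat) \<Rightarrow> (nat \<Rightarrow> nat)" where
  "comp_lr n \<beta> \<gamma> = compose {1..n} \<gamma> \<beta>"

definition variant :: "nat \<Rightarrow> (nat \<Rightarrow> nat) \<Rightarrow> (nat \<Rightarrow> nat) \<Rightarrow> (nat \<Rightarrow> nat) \<Rightarrow> (nat \<Rightarrow> nat)" where
  "variant n \<alpha> \<beta> \<gamma> = comp_lr n (comp_lr n \<beta> \<alpha>) \<gamma>"

definition im :: "nat \<Rightarrow> (nat \<Rightarrow> nat) \<Rightarrow> nat set" where
  "im n \<beta> = \<beta> ` {1..n}"

definition rank :: "nat \<Rightarrow> (nat \<Rightarrow> nat) \<Rightarrow> nat" where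
  "rank n \<beta> = card (im n \<beta>)"

definition kernel_rel :: "nat \<Rightarrow> (nat \<Rightarrow> nat) \<Rightarrow> (nat \<times> nat) set" where
  "kernel_rel n \<beta> = {(x, y). x \<in> {1..n} \<and> y \<in> {1..n} \<and> \<beta> x = \<beta> y}"

definition kernel :: "nat \<Rightarrow> (nat \<Rightarrow> nat) \<Rightarrow> nat set set" where
  "kernel n \<beta> = {1..n} // kernel_rel n \<beta>"

definition sqrt_set :: "nat \<Rightarrow> (nat \<Rightarrow> nat) \<Rightarrow> (nat \<Rightarrow> nat) \<Rightarrow> (nat \<Rightarrow> nat) set" where
  "sqrt_set n \<alpha> \<epsilon> = {\<beta> \<in> maps n. \<epsilon> \<in> cyclic_subsemigroup (variant n \<alpha>) \<beta>}"

definition stable_rank :: "nat \<Rightarrow> (nat \<Rightarrow> nat) \<Rightarrow> (nat \<Rightarrow> nat) \<Rightarrow> nat" where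
  "stable_rank n \<alpha> \<beta> =
     rank n (THE \<epsilon>. \<epsilon> \<in> cyclic_subsemigroup (variant n \<alpha>) \<beta> \<and> is_idempotent (variant n \<alpha>) \<epsilon>)"

definition stable_maps :: "nat \<Rightarrow> (nat \<Rightarrow> nat) \<Rightarrow> nat \<Rightarrow> (nat \<Rightarrow> nat) set" where
  "stable_maps n \<alpha> l = {\<beta> \<in> maps n. stable_rank n \<alpha> \<beta> = l}"

definition XX :: "nat \<Rightarrow> (nat \<Rightarrow> nat) \<Rightarrow> nat set set set" where
  "XX n \<alpha> = {P. partition_on {1..n} P \<and> card P = rank n \<alpha> \<and>
     (\<forall>a \<in> im n \<alpha>. \<forall>a' \<in> im n \<alpha>. a \<noteq> a' \<longrightarrow> \<not> (\<exists>B\<in>P. a \<in> B \<and> a' \<in> B))}"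

text \<open>The choices \<open>b\<^sub>i \<in> A\<^sub>i\<close> are indexed by the kernel blocks \<open>A\<^sub>i\<close> of \<open>\<alpha>\<close> themselves.\<close>

definition YY :: "nat \<Rightarrow> (nat \<Rightarrow> nat) \<Rightarrow> nat set set" where
  "YY n \<alpha> = {b ` kernel n \<alpha> | b. \<forall>K \<in> kernel n \<alpha>. b K \<in> K}"

definition F :: "nat \<Rightarrow> (nat \<Rightarrow> nat) \<Rightarrow> nat set set set \<Rightarrow> nat set set \<Rightarrow> (nat \<Rightarrow> nat) set" where
  "F n \<alpha> X Y = \<Union> {sqrt_set n \<alpha> \<epsilon> | \<epsilon>. \<epsilon> \<in> maps n \<and> is_idempotent (variant n \<alpha>) \<epsilon> \<and>
     rank n \<epsilon> = rank n \<alpha> \<and> kernel n \<epsilon> \<in> X \<and> im n \<epsilon> \<in> Y}"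

end

(*
The map sending \<beta> to x \<mapsto> \<alpha> (\<beta> x) on A = im \<alpha> is a homomorphism from the variant onto the full transformation
semigroup of A; the elements of stable rank l are those sent to permutations (stab). Their idempotent power is
determined by ker \<beta>, the kernel of x \<mapsto> \<alpha> (\<beta> x), and rng \<beta> = \<beta> ` A. In a product of two such elements ker comes
from the first factor and rng from the second.

T is completely isolated iff it is non-empty and both T and its complement are closed (splits). Then elements
of stab with equal ker and rng lie on the same side. If \<beta> in T, \<beta>' not in T have equal ker, and \<gamma> in T, \<gamma>' not in T
have equal rng, then \<beta> \<star> \<gamma> and \<beta>' \<star> \<gamma>' agree in both invariants but lie on different sides; so on stab membership
depends on ker alone or on rng alone. Outside stab, every element lies on the same side as a constant map
(idempotent_reduce_rank), and all constants lie on one side because some \<beta> exchanges two given ones.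
*)

theory Submission
  imports Defs "HOL-Combinatorics.Permutations"
begin

section \<open>Powers and idempotents in a finite semigroup\<close>

context
  fixes S :: "'a set" and f :: "'a \<Rightarrow> 'a \<Rightarrow> 'a"
  assumes closed: "\<And>x y. x \<in> S \<Longrightarrow> y \<in> S \<Longrightarrow> f x y \<in> S"
    and assoc: "\<And>x y z. x \<in> S \<Longrightarrow> y \<in> S \<Longrightarrow> z \<in> S \<Longrightarrow> f (f x y) z = f x (f y z)"
begin

lemma power_Suc_closed: "x \<in> S \<Longrightarrow> power_Suc f x k \<in> S"
  by (induction k) (auto intro: closed)

lemma power_Suc_mult:
  assumes "x \<in> S"
  shows "f (power_Suc f x i) (power_Suc f x j) = power_Suc f x (Suc (i + j))"
  using assms by (induction j) (auto simp: assoc[symmetric] power_Suc_closed)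

text \<open>The index is (i+1)(j+1) - 1, because \<open>power_Suc f x k\<close> stands for the power
  with exponent k+1.\<close>

lemma power_Suc_power_Suc:
  assumes "x \<in> S"
  shows "power_Suc f (power_Suc f x i) j = power_Suc f x (i + j * Suc i)"
  by (induction j) (simp_all add: power_Suc_mult[OF assms] algebra_simps)

lemma power_Suc_idempotent:
  assumes "is_idempotent f e"
  shows "power_Suc f e k = e"
  using assms by (induction k) (auto simp: is_idempotent_def)

text \<open>Idempotents equal all their powers, so both elements equal the power of x with exponent
  (i+1)(j+1).\<close>

lemma cyclic_idempotent_unique:
  assumes "x \<in> S" "d \<in> cyclic_subsemigroup f x" "e \<in> cyclic_subsemigroup f x"
    and "is_idempotent f d" "is_idempotent f e"
  shows "d = e"
proof -
  obtain i j where ij: "d = power_Suc f x i" "e = power_Suc f x j"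
    using assms by (auto simp: cyclic_subsemigroup_def)
  have "d = power_Suc f d j" "e = power_Suc f e i"
    using assms by (simp_all add: power_Suc_idempotent)
  then show ?thesis
    using power_Suc_power_Suc[OF assms(1), of i j] power_Suc_power_Suc[OF assms(1), of j i] ij
    by (simp add: algebra_simps)
qed

text \<open>Two powers of x coincide by finiteness, so the powers are periodic from some index on.
  An exponent that is a large enough multiple of the period gives an idempotent.\<close>

lemma cyclic_idempotent_exists:
  assumes "finite S" "x \<in> S"
  shows "\<exists>e \<in> cyclic_subsemigroup f x. is_idempotent f e"
proof -
  let ?p = "power_Suc f x"
  have "range ?p \<subseteq> S"
    using assms power_Suc_closed by auto
  then have "finite (range ?p)"
    using assms finite_subset by blast
  then have "\<not> inj ?p"
    using finite_imageD infinite_UNIV_nat by blast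
  then obtain i j where "?p i = ?p j" "i < j"
    by (metis injI linorder_neq_iff)
  then obtain d where d: "?p (i + d) = ?p i" "d > 0"
    by (metis less_imp_add_positive)
  have shift: "?p (i + r + d) = ?p (i + r)" for r
    by (induction r) (use d in auto)
  have per: "?p (i + r + m * d) = ?p (i + r)" for r m
  proof (induction m)
    case (Suc m)
    have "?p (i + r + Suc m * d) = ?p (i + (r + m * d) + d)"
      by (simp add: algebra_simps)
    also have "\<dots> = ?p (i + r)"
      using shift[of "r + m * d"] Suc by (simp add: algebra_simps)
    finally show ?case .
  qed simp
  \<comment> \<open>The index is shifted by one so that the exponent \<open>Suc k\<close> is a
    multiple of the period \<open>d\<close>. Since \<open>k\<close> is at least \<open>i\<close>,
    squaring moves the index by a multiple of the period within the periodic range.\<close>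
  define k where "k = Suc i * d - 1"
  have k: "Suc k = Suc i * d"
    using d(2) by (cases d) (simp_all add: k_def)
  have "Suc i * 1 \<le> Suc i * d"
    using d(2) by (intro mult_le_mono2) simp
  then have "i \<le> k"
    using k by simp
  have "f (?p k) (?p k) = ?p (k + Suc i * d)"
    using power_Suc_mult[OF assms(2), of k k] k by (metis add_Suc_right)
  also have "\<dots> = ?p k"
    using per[of "k - i" "Suc i"] \<open>i \<le> k\<close> by simp
  finally show ?thesis
    by (auto simp: cyclic_subsemigroup_def is_idempotent_def)
qed

end

text \<open>The set \<open>{1..n}\<close> is treated as an atom from here on: the simplifier must
  neither unfold membership in it nor rewrite its lower bound to \<open>Suc 0\<close>.\<close>

declare atLeastAtMost_iff [simp del] One_nat_def [simp del]

section \<open>Kernels of maps, and permutations with two prescribed values\<close>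

lemma equiv_kernel_rel: "equiv {1..n} (kernel_rel n f)"
  by (rule equivI) (auto simp: kernel_rel_def refl_on_def sym_def trans_def)

text \<open>The relation is recovered from the partition as the union of the squares of its
  blocks.\<close>

lemma kernel_eq_iff: "kernel n f = kernel n g \<longleftrightarrow> kernel_rel n f = kernel_rel n g"
proof
  assume eq: "kernel n f = kernel n g"
  have "kernel_rel n h = (\<Union>B\<in>kernel n h. B \<times> B)" for h
    by (auto simp: kernel_def quotient_def kernel_rel_def)
  then show "kernel_rel n f = kernel_rel n g"
    using eq by metis
qed (simp add: kernel_def)

lemma kernel_eqI:
  assumes "\<And>x y. x \<in> {1..n} \<Longrightarrow> y \<in> {1..n} \<Longrightarrow> f x = f y \<longleftrightarrow> g x = g y"
  shows "kernel n f = kernel n g"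
  unfolding kernel_eq_iff using assms by (auto simp: kernel_rel_def)

lemma kernel_eqD:
  assumes "kernel n f = kernel n g" "x \<in> {1..n}" "y \<in> {1..n}" "f x = f y"
  shows "g x = g y"
  using assms unfolding kernel_eq_iff by (auto simp: kernel_rel_def)

lemma kernel_blockD: "B \<in> kernel n f \<Longrightarrow> x \<in> B \<Longrightarrow> y \<in> B \<Longrightarrow> f x = f y"
  by (auto simp: kernel_def quotient_def kernel_rel_def)

text \<open>Indexing the blocks by values instead of points makes the indexing injective on the
  image, since fibres over the image are non-empty; counting blocks then becomes counting
  values.\<close>

lemma kernel_alt: "kernel n f = (\<lambda>c. {x \<in> {1..n}. f x = c}) ` f ` {1..n}"
proof -
  have "kernel_rel n f `` {x} = {y \<in> {1..n}. f y = f x}" if "x \<in> {1..n}" for x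
    using that by (auto simp: kernel_rel_def)
  then have "kernel n f = (\<lambda>x. {y \<in> {1..n}. f y = f x}) ` {1..n}"
    by (auto simp: kernel_def quotient_def)
  then show ?thesis
    unfolding image_image .
qed

lemma card_kernel: "card (kernel n f) = card (f ` {1..n})"
  unfolding kernel_alt by (intro card_image inj_onI) blast

text \<open>A first transposition takes b1 to a1 and b2 to some c different from a1. A second one
  takes c to a2 and fixes a1.\<close>

lemma transversal_ex_permutes:
  assumes "b1 \<in> A" "b2 \<in> A" "b1 \<noteq> b2" "a1 \<in> A" "a2 \<in> A" "a1 \<noteq> a2"
  obtains p where "p permutes A" "p b1 = a1" "p b2 = a2"
proof -
  define c where "c = transpose b1 a1 b2"
  have c: "c \<in> A" "c \<noteq> a1"
    using assms by (auto simp: c_def transpose_def)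
  show ?thesis
  proof
    show "transpose c a2 \<circ> transpose b1 a1 permutes A"
      using assms c by (intro permutes_compose permutes_swap_id)
    show "(transpose c a2 \<circ> transpose b1 a1) b1 = a1"
      using assms c by (simp add: transpose_def)
    show "(transpose c a2 \<circ> transpose b1 a1) b2 = a2"
      by (simp flip: c_def)
  qed
qed

section \<open>The variant, the induced self-maps of the image of \<alpha>, and the invariants of
  products\<close>

locale idempotent_variant =
  fixes n :: nat and \<alpha> :: "nat \<Rightarrow> nat"
  assumes alpha_maps: "\<alpha> \<in> maps n"
    and alpha_idem: "is_idempotent (comp_lr n) \<alpha>"
    and rank_gt_1: "rank n \<alpha> > 1"
begin

abbreviation star (infixl "\<star>" 70) where "\<beta> \<star> \<gamma> \<equiv> variant n \<alpha> \<beta> \<gamma>"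

definition A where "A = im n \<alpha>"

definition stab where "stab = {\<beta> \<in> maps n. (\<lambda>x. \<alpha> (\<beta> x)) ` A = A}"

definition ker where "ker \<beta> = kernel n (\<lambda>x. \<alpha> (\<beta> x))"

definition rng where "rng \<beta> = \<beta> ` A" for \<beta> :: "nat \<Rightarrow> nat"

definition cst where "cst z = (\<lambda>_\<in>{1..n}. z)" for z :: nat

lemma maps_in: "\<beta> \<in> maps n \<Longrightarrow> x \<in> {1..n} \<Longrightarrow> \<beta> x \<in> {1..n}"
  unfolding maps_def by blast

lemma maps_eqI:
  assumes "\<beta> \<in> maps n" "\<gamma> \<in> maps n" "\<And>x. x \<in> {1..n} \<Longrightarrow> \<beta> x = \<gamma> x"
  shows "\<beta> = \<gamma>"
  using assms unfolding maps_def by (metis PiE_ext)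

lemma star_apply: "x \<in> {1..n} \<Longrightarrow> (\<beta> \<star> \<gamma>) x = \<gamma> (\<alpha> (\<beta> x))"
  by (simp add: variant_def comp_lr_def compose_def)

lemma star_maps:
  assumes "\<beta> \<in> maps n" "\<gamma> \<in> maps n"
  shows "\<beta> \<star> \<gamma> \<in> maps n"
proof -
  have "\<beta> \<star> \<gamma> = (\<lambda>x\<in>{1..n}. \<gamma> (\<alpha> (\<beta> x)))"
    by (rule ext) (simp add: variant_def comp_lr_def compose_def)
  then show ?thesis
    using maps_in[OF assms(1)] maps_in[OF assms(2)] maps_in[OF alpha_maps] by (simp add: maps_def)
qed

lemma A_subset: "A \<subseteq> {1..n}"
  using maps_in[OF alpha_maps] by (auto simp: A_def im_def)

lemma finite_A: "finite A"
  using A_subset finite_subset by blast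

lemma A_in: "a \<in> A \<Longrightarrow> a \<in> {1..n}"
  using A_subset by blast

lemma A_nonempty: "A \<noteq> {}"
  using rank_gt_1 unfolding rank_def A_def[symmetric] by auto

lemma alpha_in_A: "x \<in> {1..n} \<Longrightarrow> \<alpha> x \<in> A"
  by (simp add: A_def im_def)

lemma alpha_in: "x \<in> {1..n} \<Longrightarrow> \<alpha> x \<in> {1..n}"
  by (rule A_in) (rule alpha_in_A)

lemma alpha_maps_in_A: "\<beta> \<in> maps n \<Longrightarrow> x \<in> {1..n} \<Longrightarrow> \<alpha> (\<beta> x) \<in> A"
  by (rule alpha_in_A) (rule maps_in)


lemma alpha_alpha: "x \<in> {1..n} \<Longrightarrow> \<alpha> (\<alpha> x) = \<alpha> x"
  using alpha_idem unfolding is_idempotent_def comp_lr_def by (metis compose_eq)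

lemma alpha_A: "a \<in> A \<Longrightarrow> \<alpha> a = a"
  by (auto simp: A_def im_def alpha_alpha)

lemma star_assoc:
  assumes "\<beta> \<in> maps n" "\<gamma> \<in> maps n" "\<delta> \<in> maps n"
  shows "\<beta> \<star> \<gamma> \<star> \<delta> = \<beta> \<star> (\<gamma> \<star> \<delta>)"
  using assms by (intro maps_eqI) (auto simp: star_maps star_apply alpha_in maps_in)

lemma pow_closed: "\<beta> \<in> maps n \<Longrightarrow> power_Suc (variant n \<alpha>) \<beta> k \<in> maps n"
  by (rule power_Suc_closed[of "maps n"]) (auto simp: star_maps star_assoc)

lemma finite_maps: "finite (maps n)"
  by (simp add: maps_def finite_PiE)

lemma idempotent_power:
  assumes "\<beta> \<in> maps n"
  obtains k where "is_idempotent (variant n \<alpha>) (power_Suc (variant n \<alpha>) \<beta> k)"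
proof -
  have "\<exists>\<epsilon>\<in>cyclic_subsemigroup (variant n \<alpha>) \<beta>. is_idempotent (variant n \<alpha>) \<epsilon>"
    by (rule cyclic_idempotent_exists[of "maps n"]) (simp_all add: star_maps star_assoc finite_maps assms)
  then show thesis
    using that by (auto simp: cyclic_subsemigroup_def)
qed

lemma stab_maps: "\<beta> \<in> stab \<Longrightarrow> \<beta> \<in> maps n"
  by (simp add: stab_def)

lemma stab_inj: "\<beta> \<in> stab \<Longrightarrow> inj_on (\<lambda>x. \<alpha> (\<beta> x)) A"
  unfolding stab_def by (auto intro!: eq_card_imp_inj_on finite_A)

lemma stabI_inj:
  assumes "\<beta> \<in> maps n" "inj_on (\<lambda>x. \<alpha> (\<beta> x)) A"
  shows "\<beta> \<in> stab"
proof -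
  have "(\<lambda>x. \<alpha> (\<beta> x)) ` A \<subseteq> A"
    using alpha_maps_in_A[OF assms(1)] A_in by blast
  from endo_inj_surj[OF finite_A this assms(2)] show ?thesis
    using assms(1) by (simp add: stab_def)
qed

lemma stab_injD:
  "\<beta> \<in> stab \<Longrightarrow> \<alpha> (\<beta> a) = \<alpha> (\<beta> b) \<Longrightarrow> a \<in> A \<Longrightarrow> b \<in> A \<Longrightarrow> a = b"
  using stab_inj by (auto dest: inj_onD)

lemma stab_surjD:
  assumes "\<beta> \<in> stab" "a \<in> A"
  obtains a' where "a' \<in> A" "\<alpha> (\<beta> a') = a"
proof -
  have "a \<in> (\<lambda>x. \<alpha> (\<beta> x)) ` A"
    using assms by (simp add: stab_def)
  then show thesis
    using that by blast
qed

text \<open>The product induces on \<open>A\<close> the composite of the two induced self-maps, and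
  a composite of self-maps of a finite set is onto only if both are.\<close>

lemma star_stab_iff:
  assumes "\<beta> \<in> maps n" "\<gamma> \<in> maps n"
  shows "\<beta> \<star> \<gamma> \<in> stab \<longleftrightarrow> \<beta> \<in> stab \<and> \<gamma> \<in> stab"
proof -
  define f g where "f = (\<lambda>x. \<alpha> (\<beta> x))" and "g = (\<lambda>x. \<alpha> (\<gamma> x))"
  have "(\<lambda>x. \<alpha> ((\<beta> \<star> \<gamma>) x)) ` A = g ` f ` A"
    unfolding image_image f_def g_def by (rule image_cong) (auto simp: star_apply A_in)
  moreover have "f ` A \<subseteq> A" "g ` A \<subseteq> A"
    using assms by (auto simp: f_def g_def alpha_maps_in_A A_in)
  moreover have "f ` A = A" if "g ` f ` A = A"
  proof (rule card_subset_eq[OF finite_A \<open>f ` A \<subseteq> A\<close>])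
    have "card A \<le> card (f ` A)"
      using card_image_le[of "f ` A" g] finite_A that by simp
    then show "card (f ` A) = card A"
      using card_image_le[OF finite_A, of f] by simp
  qed
  ultimately have "(\<lambda>x. \<alpha> ((\<beta> \<star> \<gamma>) x)) ` A = A \<longleftrightarrow> f ` A = A \<and> g ` A = A"
    by metis
  then show ?thesis
    using assms by (simp add: stab_def star_maps f_def g_def)
qed

text \<open>After the first factor only a map injective on \<open>A\<close> is applied, so no
  further points are identified.\<close>

lemma ker_star:
  assumes "\<beta> \<in> maps n" "\<gamma> \<in> stab"
  shows "ker (\<beta> \<star> \<gamma>) = ker \<beta>"
  unfolding ker_def
proof (rule kernel_eqI)
  fix x y assume "x \<in> {1..n}" "y \<in> {1..n}"
  then show "\<alpha> ((\<beta> \<star> \<gamma>) x) = \<alpha> ((\<beta> \<star> \<gamma>) y) \<longleftrightarrow> \<alpha> (\<beta> x) = \<alpha> (\<beta> y)"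
    using assms by (auto simp: star_apply alpha_maps_in_A dest: stab_injD)
qed

text \<open>The first factor followed by \<alpha> already maps \<open>A\<close> onto
  \<open>A\<close>, so the second factor is evaluated on all of \<open>A\<close>.\<close>

lemma rng_star:
  assumes "\<beta> \<in> stab"
  shows "rng (\<beta> \<star> \<gamma>) = rng \<gamma>"
proof -
  have "rng (\<beta> \<star> \<gamma>) = \<gamma> ` (\<lambda>x. \<alpha> (\<beta> x)) ` A"
    unfolding rng_def image_image by (rule image_cong) (auto simp: star_apply A_in)
  then show ?thesis
    using assms by (simp add: rng_def stab_def)
qed

lemma power_stab_iff:
  "\<beta> \<in> maps n \<Longrightarrow> power_Suc (variant n \<alpha>) \<beta> k \<in> stab \<longleftrightarrow> \<beta> \<in> stab"
  by (induction k) (auto simp: star_stab_iff pow_closed)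

lemma ker_power: "\<beta> \<in> stab \<Longrightarrow> ker (power_Suc (variant n \<alpha>) \<beta> k) = ker \<beta>"
  by (induction k) (auto simp: ker_star pow_closed stab_maps)

lemma rng_power: "\<beta> \<in> stab \<Longrightarrow> rng (power_Suc (variant n \<alpha>) \<beta> k) = rng \<beta>"
  by (cases k) (auto simp: rng_star power_stab_iff stab_maps)

lemma im_power: "\<beta> \<in> maps n \<Longrightarrow> im n (power_Suc (variant n \<alpha>) \<beta> k) \<subseteq> im n \<beta>"
  by (cases k) (auto simp: im_def star_apply alpha_maps_in_A A_in pow_closed)

section \<open>Idempotents of the variant\<close>

lemma idempotent_apply:
  "is_idempotent (variant n \<alpha>) \<epsilon> \<Longrightarrow> x \<in> {1..n} \<Longrightarrow> \<epsilon> (\<alpha> (\<epsilon> x)) = \<epsilon> x"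
  using star_apply[of x \<epsilon> \<epsilon>] by (simp add: is_idempotent_def)

context
  fixes \<epsilon>
  assumes eps: "\<epsilon> \<in> maps n" "is_idempotent (variant n \<alpha>) \<epsilon>"
begin

lemma idempotent_alpha_inj: "inj_on \<alpha> (im n \<epsilon>)"
  by (rule inj_on_inverseI[where g = \<epsilon>]) (auto simp: im_def idempotent_apply[OF eps(2)])

text \<open>The sets \<open>F n \<alpha> X Y\<close> are defined by the ordinary kernel and image of
  an idempotent, whereas \<open>ker\<close> and \<open>rng\<close> are what powers preserve on
  \<open>stab\<close>. For idempotents the two agree, because \<alpha> is injective on the
  image.\<close>

lemma kernel_idempotent: "kernel n \<epsilon> = ker \<epsilon>"
  unfolding ker_def by (rule kernel_eqI) (metis idempotent_apply[OF eps(2)])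

lemma im_idempotent: "im n \<epsilon> = rng \<epsilon>"
proof
  show "im n \<epsilon> \<subseteq> rng \<epsilon>"
    unfolding im_def rng_def
    using idempotent_apply[OF eps(2)] alpha_maps_in_A[OF eps(1)] by (metis imageI image_subsetI)
qed (use A_in in \<open>auto simp: im_def rng_def\<close>)

text \<open>Applying \<alpha> to the image loses no points and yields the image of the induced
  self-map of \<open>A\<close>; its size is that of \<open>A\<close> only if this self-map is
  onto.\<close>

lemma rank_idempotent: "rank n \<epsilon> = rank n \<alpha> \<longleftrightarrow> \<epsilon> \<in> stab"
proof -
  have "rank n \<epsilon> = card (\<alpha> ` im n \<epsilon>)"
    unfolding rank_def by (rule card_image[symmetric]) (rule idempotent_alpha_inj)
  also have "\<alpha> ` im n \<epsilon> = (\<lambda>x. \<alpha> (\<epsilon> x)) ` A"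
    unfolding im_idempotent rng_def image_image ..
  finally have "rank n \<epsilon> = card ((\<lambda>x. \<alpha> (\<epsilon> x)) ` A)" .
  moreover have "(\<lambda>x. \<alpha> (\<epsilon> x)) ` A \<subseteq> A"
    using alpha_maps_in_A[OF eps(1)] A_in by blast
  moreover have "rank n \<alpha> = card A"
    by (simp add: rank_def A_def)
  ultimately show ?thesis
    using eps card_subset_eq[OF finite_A] by (auto simp: stab_def)
qed

text \<open>The induced self-map of \<open>A\<close> is idempotent and injective, hence the
  identity.\<close>

lemma stab_idempotent_alpha:
  assumes "\<epsilon> \<in> stab" "a \<in> A"
  shows "\<alpha> (\<epsilon> a) = a"
  using assms idempotent_apply[OF eps(2)] alpha_maps_in_A[OF eps(1)] A_in
  by (metis stab_injD)

end

text \<open>The common kernel decides which point of \<open>A\<close> shares a block with x, and the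
  common range contains only one element that \<alpha> sends to this point. Both idempotents send x
  to that element.\<close>

lemma stab_idempotent_unique:
  assumes d: "\<delta> \<in> stab" "is_idempotent (variant n \<alpha>) \<delta>"
    and e: "\<epsilon> \<in> stab" "is_idempotent (variant n \<alpha>) \<epsilon>"
    and eq: "ker \<delta> = ker \<epsilon>" "rng \<delta> = rng \<epsilon>"
  shows "\<delta> = \<epsilon>"
proof (rule maps_eqI)
  note dm = stab_maps[OF d(1)] and em = stab_maps[OF e(1)]
  fix x assume x: "x \<in> {1..n}"
  \<comment> \<open>This is the point of \<open>A\<close> in the block of x, since \<epsilon>
    induces the identity on \<open>A\<close>.\<close>
  define a where "a = \<alpha> (\<epsilon> x)"
  have a: "a \<in> A" "a \<in> {1..n}"
    using x em by (auto simp: a_def alpha_maps_in_A A_in)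
  have "\<alpha> (\<epsilon> x) = \<alpha> (\<epsilon> a)"
    using stab_idempotent_alpha[OF em e(2,1) a(1)] a_def by simp
  then have "\<alpha> (\<delta> x) = \<alpha> (\<delta> a)"
    using kernel_eqD eq(1) x a unfolding ker_def by metis
  then have "\<delta> x = \<delta> a"
    using idempotent_apply[OF d(2)] x a by metis
  obtain b where b: "b \<in> A" "\<delta> a = \<epsilon> b"
    using eq(2) a(1) unfolding rng_def by blast
  then have "b = a"
    using stab_idempotent_alpha[OF em e(2,1) b(1)] stab_idempotent_alpha[OF dm d(2,1) a(1)] by simp
  then show "\<delta> x = \<epsilon> x"
    using b \<open>\<delta> x = \<delta> a\<close> idempotent_apply[OF e(2) x] a_def by simp
qed (use d e stab_maps in auto)

section \<open>Stable rank and the sets \<open>F\<close> in terms of \<open>stab\<close>,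
  \<open>ker\<close> and \<open>rng\<close>\<close>

lemma stable_maps_eq: "stable_maps n \<alpha> (rank n \<alpha>) = stab"
proof -
  have "stable_rank n \<alpha> \<beta> = rank n \<alpha> \<longleftrightarrow> \<beta> \<in> stab" if b: "\<beta> \<in> maps n" for \<beta>
  proof -
    obtain k where k: "is_idempotent (variant n \<alpha>) (power_Suc (variant n \<alpha>) \<beta> k)"
      using idempotent_power[OF b] .
    let ?e = "power_Suc (variant n \<alpha>) \<beta> k"
    have "(THE \<epsilon>. \<epsilon> \<in> cyclic_subsemigroup (variant n \<alpha>) \<beta> \<and> is_idempotent (variant n \<alpha>) \<epsilon>) = ?e"
    proof (rule the_equality)
      show e: "?e \<in> cyclic_subsemigroup (variant n \<alpha>) \<beta> \<and> is_idempotent (variant n \<alpha>) ?e"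
        using k by (simp add: cyclic_subsemigroup_def)
      fix d assume "d \<in> cyclic_subsemigroup (variant n \<alpha>) \<beta> \<and> is_idempotent (variant n \<alpha>) d"
      with e show "d = ?e"
        using cyclic_idempotent_unique[of "maps n" "variant n \<alpha>" \<beta> d ?e] b star_maps star_assoc
        by blast
    qed
    \<comment> \<open>The idempotent has full rank exactly when it lies in \<open>stab\<close>, and
      a power lies in \<open>stab\<close> exactly when its base does.\<close>
    then show ?thesis
      using rank_idempotent[OF pow_closed[OF b] k] power_stab_iff[OF b]
      by (simp add: stable_rank_def)
  qed
  then show ?thesis
    by (auto simp: stable_maps_def stab_maps)
qed

text \<open>Passing to the idempotent power changes neither membership in \<open>stab\<close> nor,
  on \<open>stab\<close>, the two invariants; so the conditions on the idempotent can be read off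
  \<beta> itself.\<close>

lemma F_eq: "F n \<alpha> X Y = {\<beta> \<in> stab. ker \<beta> \<in> X \<and> rng \<beta> \<in> Y}"
proof (intro set_eqI iffI)
  fix \<beta> assume "\<beta> \<in> F n \<alpha> X Y"
  then obtain k where b: "\<beta> \<in> maps n" and e: "is_idempotent (variant n \<alpha>) (power_Suc (variant n \<alpha>) \<beta> k)"
    "rank n (power_Suc (variant n \<alpha>) \<beta> k) = rank n \<alpha>"
    "kernel n (power_Suc (variant n \<alpha>) \<beta> k) \<in> X" "im n (power_Suc (variant n \<alpha>) \<beta> k) \<in> Y"
    unfolding F_def sqrt_set_def cyclic_subsemigroup_def by auto
  note em = pow_closed[OF b, of k]
  have "\<beta> \<in> stab"
    using rank_idempotent[OF em e(1)] e(2) power_stab_iff[OF b] by simp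
  then show "\<beta> \<in> {\<beta> \<in> stab. ker \<beta> \<in> X \<and> rng \<beta> \<in> Y}"
    using e kernel_idempotent[OF em e(1)] im_idempotent[OF em e(1)] by (simp add: ker_power rng_power)
next
  fix \<beta> assume b: "\<beta> \<in> {\<beta> \<in> stab. ker \<beta> \<in> X \<and> rng \<beta> \<in> Y}"
  then have bm: "\<beta> \<in> maps n"
    by (simp add: stab_maps)
  obtain k where k: "is_idempotent (variant n \<alpha>) (power_Suc (variant n \<alpha>) \<beta> k)"
    using idempotent_power[OF bm] .
  let ?e = "power_Suc (variant n \<alpha>) \<beta> k"
  have em: "?e \<in> maps n" and es: "?e \<in> stab"
    using b bm by (simp_all add: pow_closed power_stab_iff)
  have "\<beta> \<in> sqrt_set n \<alpha> ?e"
    using bm by (simp add: sqrt_set_def cyclic_subsemigroup_def)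
  moreover have "rank n ?e = rank n \<alpha>" "kernel n ?e \<in> X" "im n ?e \<in> Y"
    using b es rank_idempotent[OF em k] kernel_idempotent[OF em k] im_idempotent[OF em k]
    by (simp_all add: ker_power rng_power)
  ultimately show "\<beta> \<in> F n \<alpha> X Y"
    unfolding F_def using em k by blast
qed

section \<open>Which kernels and ranges occur\<close>

lemma kernel_alpha: "kernel n \<alpha> = (\<lambda>a. {x \<in> {1..n}. \<alpha> x = a}) ` A"
  by (simp add: kernel_alt A_def im_def)

text \<open>The induced permutation of \<open>A\<close> is used twice: being onto, it gives as many
  blocks as \<open>A\<close> has points; being injective, it puts different points of
  \<open>A\<close> into different blocks.\<close>

lemma ker_in_XX:
  assumes "\<beta> \<in> stab"
  shows "ker \<beta> \<in> XX n \<alpha>"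
proof -
  have "(\<lambda>x. \<alpha> (\<beta> x)) ` {1..n} = A"
  proof
    show "A \<subseteq> (\<lambda>x. \<alpha> (\<beta> x)) ` {1..n}"
      using A_in by (blast elim: stab_surjD[OF assms])
  qed (use assms stab_maps alpha_maps_in_A in blast)
  then have "card (ker \<beta>) = rank n \<alpha>"
    by (simp add: ker_def card_kernel rank_def A_def)
  moreover have "partition_on {1..n} (ker \<beta>)"
    unfolding ker_def kernel_def by (rule partition_on_quotient) (rule equiv_kernel_rel)
  moreover have "a = a'" if "a \<in> A" "a' \<in> A" "B \<in> ker \<beta>" "a \<in> B" "a' \<in> B" for a a' B
    using that assms kernel_blockD stab_injD unfolding ker_def by metis
  ultimately show ?thesis
    unfolding XX_def A_def[symmetric] by blast
qed

text \<open>Each kernel block of \<alpha> meets \<open>rng \<beta>\<close> in exactly one point: in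
  at least one because the induced map is onto, in at most one because it is injective. The choice
  function picks this point.\<close>

lemma rng_in_YY:
  assumes "\<beta> \<in> stab"
  shows "rng \<beta> \<in> YY n \<alpha>"
proof -
  define b where "b K = (SOME y. y \<in> rng \<beta> \<inter> K)" for K
  have bK: "b K \<in> rng \<beta> \<inter> K" if "K \<in> kernel n \<alpha>" for K
    unfolding b_def
  proof (rule someI_ex)
    obtain a where a: "a \<in> A" "K = {x \<in> {1..n}. \<alpha> x = a}"
      using \<open>K \<in> kernel n \<alpha>\<close> by (auto simp: kernel_alpha)
    then obtain a' where "a' \<in> A" "\<alpha> (\<beta> a') = a"
      using stab_surjD[OF assms] by metis
    then have "\<beta> a' \<in> rng \<beta> \<inter> K"
      using a maps_in[OF stab_maps[OF assms]] A_in by (auto simp: rng_def)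
    then show "\<exists>y. y \<in> rng \<beta> \<inter> K" ..
  qed
  have "b ` kernel n \<alpha> = rng \<beta>"
  proof
    show "rng \<beta> \<subseteq> b ` kernel n \<alpha>"
    proof
      fix y assume "y \<in> rng \<beta>"
      then obtain a where a: "a \<in> A" "y = \<beta> a"
        by (auto simp: rng_def)
      define K where "K = {x \<in> {1..n}. \<alpha> x = \<alpha> y}"
      have "\<alpha> y \<in> A"
        using a alpha_maps_in_A[OF stab_maps[OF assms]] A_in by simp
      then have K: "K \<in> kernel n \<alpha>"
        by (auto simp: kernel_alpha K_def)
      obtain a' where "a' \<in> A" "b K = \<beta> a'" "\<alpha> (\<beta> a') = \<alpha> y"
        using bK[OF K] by (auto simp: rng_def K_def)
      then have "b K = y"
        using a stab_injD[OF assms] by metis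
      then show "y \<in> b ` kernel n \<alpha>"
        using K by blast
    qed
  qed (use bK in blast)
  then show ?thesis
    unfolding YY_def using bK by blast
qed

text \<open>The map \<beta> sends x to \<open>s (r x)\<close>, where \<open>r x\<close> is the point
  of \<open>A\<close> in the block of x in \<open>P\<close> and \<open>s a\<close> is the point of
  \<open>Q\<close> that \<alpha> sends to a. The induced map is then \<open>r\<close>, which fixes
  \<open>A\<close> pointwise and has kernel \<open>P\<close>.\<close>

lemma stab_exists:
  assumes P: "P \<in> XX n \<alpha>" and Q: "Q \<in> YY n \<alpha>"
  obtains \<beta> where "\<beta> \<in> stab" "ker \<beta> = P" "rng \<beta> = Q"
proof -
  have part: "partition_on {1..n} P" and card: "card P = card A"
    and sep: "\<And>a a' B. a \<in> A \<Longrightarrow> a' \<in> A \<Longrightarrow> B \<in> P \<Longrightarrow> a \<in> B \<Longrightarrow> a' \<in> B \<Longrightarrow> a = a'"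
    using P unfolding XX_def rank_def A_def[symmetric] by blast+
  have "\<forall>a\<in>A. \<exists>B\<in>P. a \<in> B"
    using part A_in by (auto simp: partition_on_def)
  then obtain K where K: "\<And>a. a \<in> A \<Longrightarrow> K a \<in> P" "\<And>a. a \<in> A \<Longrightarrow> a \<in> K a"
    by metis
  have "finite P"
    using finite_elements[OF _ part] by simp
  have "inj_on K A"
    using K sep by (intro inj_onI) metis
  then have KA: "K ` A = P"
    using K card \<open>finite P\<close> by (intro card_subset_eq) (auto simp: card_image)
  have uniq: "B = B'" if "B \<in> P" "B' \<in> P" "x \<in> B" "x \<in> B'" for B B' x
    using part that by (auto simp: partition_on_def disjoint_def)
  have "\<forall>x\<in>{1..n}. \<exists>a\<in>A. x \<in> K a"
    using part KA by (auto simp: partition_on_def)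
  then obtain r where r: "\<And>x. x \<in> {1..n} \<Longrightarrow> r x \<in> A" "\<And>x. x \<in> {1..n} \<Longrightarrow> x \<in> K (r x)"
    by metis
  have r_iff: "r x = a \<longleftrightarrow> x \<in> K a" if "x \<in> {1..n}" "a \<in> A" for x a
    using that r K uniq \<open>inj_on K A\<close> by (metis inj_onD)
  have rA: "r a = a" if "a \<in> A" for a
    using that r_iff A_in K by blast
  have K_sub: "K a \<subseteq> {1..n}" if "a \<in> A" for a
    using K(1)[OF that] part by (auto simp: partition_on_def)
  obtain b where b: "Q = b ` kernel n \<alpha>" "\<And>B. B \<in> kernel n \<alpha> \<Longrightarrow> b B \<in> B"
    using Q by (auto simp: YY_def)
  define s where "s a = b {x \<in> {1..n}. \<alpha> x = a}" for a
  have s: "s a \<in> {1..n}" "\<alpha> (s a) = a" if "a \<in> A" for a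
    using b(2)[of "{x \<in> {1..n}. \<alpha> x = a}"] that by (auto simp: s_def kernel_alpha)
  have sA: "s ` A = Q"
    unfolding b(1) kernel_alpha image_image s_def ..
  define \<beta> where "\<beta> = (\<lambda>x\<in>{1..n}. s (r x))"
  have bx: "\<alpha> (\<beta> x) = r x" if "x \<in> {1..n}" for x
    using that r s by (simp add: \<beta>_def)
  have maps: "\<beta> \<in> maps n"
    using r s by (simp add: \<beta>_def maps_def)
  show thesis
  proof
    show "\<beta> \<in> stab"
      using maps by (intro stabI_inj inj_onI) (auto simp: bx A_in rA)
    have "r ` {1..n} = A"
      using r(1) rA A_in by (auto intro!: image_eqI[OF sym])
    moreover have "{x \<in> {1..n}. r x = a} = K a" if "a \<in> A" for a
      using that r_iff K_sub by blast
    ultimately have "kernel n r = P"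
      unfolding kernel_alt KA[symmetric] by (metis (no_types, lifting) image_cong)
    moreover have "ker \<beta> = kernel n r"
      unfolding ker_def by (rule kernel_eqI) (simp add: bx)
    ultimately show "ker \<beta> = P"
      by simp
    have "\<beta> ` A = s ` A"
      by (rule image_cong) (auto simp: \<beta>_def A_in rA)
    then show "rng \<beta> = Q"
      by (simp add: rng_def sA)
  qed
qed

section \<open>Completely isolated sets on \<open>stab\<close>\<close>

definition splits where
  "splits T \<longleftrightarrow> T \<subseteq> maps n \<and>
    (\<forall>\<beta>\<in>maps n. \<forall>\<gamma>\<in>maps n. (\<beta> \<in> T \<longleftrightarrow> \<gamma> \<in> T) \<longrightarrow> (\<beta> \<star> \<gamma> \<in> T \<longleftrightarrow> \<beta> \<in> T))"

lemma splitsD: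
  "splits T \<Longrightarrow> \<beta> \<in> maps n \<Longrightarrow> \<gamma> \<in> maps n \<Longrightarrow> (\<beta> \<in> T \<longleftrightarrow> \<gamma> \<in> T) \<Longrightarrow> \<beta> \<star> \<gamma> \<in> T \<longleftrightarrow> \<beta> \<in> T"
  unfolding splits_def by blast

text \<open>Non-emptiness is kept outside \<open>splits\<close>, so that the notion passes to
  complements.\<close>

lemma completely_isolated_iff:
  "completely_isolated (maps n) (variant n \<alpha>) T \<longleftrightarrow> splits T \<and> T \<noteq> {}"
  unfolding completely_isolated_def subsemigroup_def splits_def by (auto 4 3)

lemma splits_power:
  "splits T \<Longrightarrow> \<beta> \<in> maps n \<Longrightarrow> power_Suc (variant n \<alpha>) \<beta> k \<in> T \<longleftrightarrow> \<beta> \<in> T"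
  by (induction k) (simp_all add: splitsD pow_closed)

text \<open>Powers stay on the side of their base, and the two elements have the same idempotent
  power because it is determined by \<open>ker\<close> and \<open>rng\<close>.\<close>

lemma splits_cong:
  assumes T: "splits T" and b: "\<beta> \<in> stab" "\<gamma> \<in> stab" and eq: "ker \<beta> = ker \<gamma>" "rng \<beta> = rng \<gamma>"
  shows "\<beta> \<in> T \<longleftrightarrow> \<gamma> \<in> T"
proof -
  note bm = b[THEN stab_maps]
  obtain i where i: "is_idempotent (variant n \<alpha>) (power_Suc (variant n \<alpha>) \<beta> i)"
    using idempotent_power bm(1) .
  obtain j where j: "is_idempotent (variant n \<alpha>) (power_Suc (variant n \<alpha>) \<gamma> j)"
    using idempotent_power bm(2) .
  have "power_Suc (variant n \<alpha>) \<beta> i = power_Suc (variant n \<alpha>) \<gamma> j"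
    by (rule stab_idempotent_unique) (use i j b bm eq in \<open>auto simp: power_stab_iff ker_power rng_power\<close>)
  then show ?thesis
    using splits_power[OF T] bm by metis
qed

lemma splits_stab_cases:
  assumes T: "splits T"
  shows "(\<forall>\<beta>\<in>stab. \<forall>\<gamma>\<in>stab. ker \<beta> = ker \<gamma> \<longrightarrow> (\<beta> \<in> T \<longleftrightarrow> \<gamma> \<in> T)) \<or>
    (\<forall>\<beta>\<in>stab. \<forall>\<gamma>\<in>stab. rng \<beta> = rng \<gamma> \<longrightarrow> (\<beta> \<in> T \<longleftrightarrow> \<gamma> \<in> T))"
proof (rule ccontr)
  assume "\<not> ?thesis"
  then obtain \<beta> \<beta>' \<gamma> \<gamma>' where *: "\<beta> \<in> stab" "\<beta>' \<in> stab" "\<gamma> \<in> stab" "\<gamma>' \<in> stab"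
    "ker \<beta> = ker \<beta>'" "rng \<gamma> = rng \<gamma>'" "\<beta> \<in> T" "\<beta>' \<notin> T" "\<gamma> \<in> T" "\<gamma>' \<notin> T"
    by metis
  have "\<beta> \<star> \<gamma> \<in> T \<longleftrightarrow> \<beta>' \<star> \<gamma>' \<in> T"
    using * by (intro splits_cong[OF T]) (auto simp: star_stab_iff stab_maps ker_star rng_star)
  then show False
    using * splitsD[OF T] stab_maps by metis
qed

section \<open>Outside \<open>stab\<close>: constant maps and reduction of rank\<close>

lemma cst_maps: "z \<in> {1..n} \<Longrightarrow> cst z \<in> maps n"
  by (simp add: cst_def maps_def)

lemma cst_star: "\<beta> \<in> maps n \<Longrightarrow> z \<in> {1..n} \<Longrightarrow> cst z \<star> \<beta> = cst (\<beta> (\<alpha> z))"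
  by (intro maps_eqI) (auto simp: star_maps cst_maps maps_in alpha_in star_apply, simp_all add: cst_def)

lemma cst_not_stab:
  assumes "z \<in> {1..n}"
  shows "cst z \<notin> stab"
proof
  assume "cst z \<in> stab"
  then have "(\<lambda>x. \<alpha> (cst z x)) ` A = A"
    by (simp add: stab_def)
  moreover have "(\<lambda>x. \<alpha> (cst z x)) ` A \<subseteq> {\<alpha> z}"
    using A_in by (auto simp: cst_def)
  ultimately have "card A \<le> 1"
    by (metis card_mono card.empty card_insert_disjoint empty_iff finite.emptyI finite.insertI One_nat_def)
  then show False
    using rank_gt_1 by (simp add: rank_def A_def)
qed

lemma splits_cst:
  assumes T: "splits T" and zw: "z \<in> {1..n}" "w \<in> {1..n}"
  shows "cst z \<in> T \<longleftrightarrow> cst w \<in> T"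
proof (rule ccontr)
  define Z where "Z = {z \<in> {1..n}. cst z \<in> T}"
  define W where "W = {z \<in> {1..n}. cst z \<notin> T}"
  assume "\<not> ?thesis"
  then have ne: "Z \<noteq> {}" "W \<noteq> {}"
    using zw by (auto simp: Z_def W_def)
  have un: "{1..n} = Z \<union> W"
    by (auto simp: Z_def W_def)
  \<comment> \<open>Otherwise \<alpha> would take a single value on all of \<open>Z\<close> and
    \<open>W\<close>, hence be constant, against its rank.\<close>
  have "\<exists>z\<in>Z. \<exists>w\<in>W. \<alpha> z \<noteq> \<alpha> w"
  proof (rule ccontr)
    assume "\<not> (\<exists>z\<in>Z. \<exists>w\<in>W. \<alpha> z \<noteq> \<alpha> w)"
    then have "\<exists>c. \<forall>x\<in>{1..n}. \<alpha> x = c"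
      using ne un by (metis Un_iff ex_in_conv)
    then obtain c where "im n \<alpha> \<subseteq> {c}"
      unfolding im_def by blast
    then have "rank n \<alpha> \<le> card {c}"
      unfolding rank_def by (intro card_mono) auto
    then show False
      using rank_gt_1 by simp
  qed
  then obtain z w where z: "z \<in> {1..n}" "cst z \<in> T" and w: "w \<in> {1..n}" "cst w \<notin> T"
    and neq: "\<alpha> z \<noteq> \<alpha> w"
    by (auto simp: Z_def W_def)
  \<comment> \<open>Right multiplication by \<beta> exchanges the two constants. Whichever side
    \<beta> lies on, one of the constants lies there too and is carried to the other side.\<close>
  define \<beta> where "\<beta> = (\<lambda>x\<in>{1..n}. if x = \<alpha> z then w else z)"
  have "\<beta> \<in> maps n"
    using z w by (auto simp: \<beta>_def maps_def)
  moreover have "cst z \<star> \<beta> = cst w" "cst w \<star> \<beta> = cst z"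
    using z w neq \<open>\<beta> \<in> maps n\<close> by (auto simp: cst_star) (auto simp: \<beta>_def alpha_in)
  ultimately show False
    using splitsD[OF T, of "cst z" \<beta>] splitsD[OF T, of "cst w" \<beta>] z w cst_maps by metis
qed

text \<open>Between two copies of f an element is inserted that induces a permutation of
  \<open>A\<close> carrying two points of \<open>B\<close> to two points which f identifies. This
  lowers the rank, and the inserted element is chosen so that the product stays on the side of
  f.\<close>

lemma idempotent_reduce_rank:
  assumes T: "splits T" and f: "f \<in> maps n" "f \<notin> stab" "is_idempotent (variant n \<alpha>) f"
    and rank: "rank n f > 1"
  obtains g where "g \<in> maps n" "g \<notin> stab" "g \<in> T \<longleftrightarrow> f \<in> T" "rank n g < rank n f"
proof -
  note f_inj = idempotent_alpha_inj[OF f(1,3)]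
  define B where "B = \<alpha> ` im n f"
  have imf: "im n f \<subseteq> {1..n}"
    using maps_in[OF f(1)] by (auto simp: im_def)
  then have BA: "B \<subseteq> A"
    using alpha_in_A by (auto simp: B_def)
  have cardB: "card B = rank n f"
    unfolding B_def rank_def by (rule card_image) (rule f_inj)
  have "finite B"
    using BA finite_A finite_subset by blast
  obtain b1 b2 where bb: "b1 \<in> B" "b2 \<in> B" "b1 \<noteq> b2"
    using rank cardB \<open>finite B\<close> card_le_Suc0_iff_eq[of B] by (metis One_nat_def not_less)
  have "\<not> inj_on (\<lambda>x. \<alpha> (f x)) A"
    using f stabI_inj by blast
  then obtain a1 a2 where aa: "a1 \<in> A" "a2 \<in> A" "a1 \<noteq> a2" "\<alpha> (f a1) = \<alpha> (f a2)"
    unfolding inj_on_def by blast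
  then have faa: "f a1 = f a2"
    using f_inj A_in by (auto simp: inj_on_def im_def)
  obtain p where p: "p permutes A" "p b1 = a1" "p b2 = a2"
    using transversal_ex_permutes[of b1 A b2 a1 a2] bb aa BA by blast
  \<comment> \<open>A section of \<alpha> over \<open>A\<close> that agrees with f on
    \<open>B\<close>. The agreement gives \<open>s (\<alpha> (f x)) = f x\<close>, by which f is
    recovered exactly and not only up to \<alpha>.\<close>
  define s where "s a = (if a \<in> B then f a else a)" for a
  have s: "s a \<in> {1..n}" "\<alpha> (s a) = a" if "a \<in> A" for a
    using that A_in maps_in[OF f(1)] idempotent_apply[OF f(3)]
    by (auto simp: s_def alpha_A B_def im_def)
  have sf: "s (\<alpha> (f x)) = f x" if "x \<in> {1..n}" for x
    using that idempotent_apply[OF f(3)] by (auto simp: s_def B_def im_def)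
  \<comment> \<open>For a permutation q of \<open>A\<close>, \<open>h q\<close> induces q on
    \<open>A\<close>, while its \<open>ker\<close> and \<open>rng\<close> do not depend on q; hence
    all these elements lie on one side of \<open>T\<close>.\<close>
  define h where "h q = (\<lambda>x\<in>{1..n}. s (q (\<alpha> x)))" for q
  have h: "h q \<in> stab" "ker (h q) = kernel n \<alpha>" "rng (h q) = s ` A" if q: "q permutes A" for q
  proof -
    have qA: "q (\<alpha> x) \<in> A" if "x \<in> {1..n}" for x
      using that alpha_in_A permutes_in_image[OF q] by blast
    have inj: "q x = q y \<longleftrightarrow> x = y" for x y
      using permutes_inj[OF q] by (auto dest: injD)
    have ah: "\<alpha> (h q x) = q (\<alpha> x)" if "x \<in> {1..n}" for x
      using that s qA by (simp add: h_def)
    have "h q \<in> maps n"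
      using s qA by (simp add: h_def maps_def)
    then show "h q \<in> stab"
      by (rule stabI_inj) (auto intro!: inj_onI simp: ah A_in inj alpha_A)
    show "ker (h q) = kernel n \<alpha>"
      unfolding ker_def by (rule kernel_eqI) (simp add: ah inj)
    have "h q ` A = s ` q ` A"
      unfolding image_image by (rule image_cong) (auto simp: h_def A_in alpha_A)
    then show "rng (h q) = s ` A"
      using permutes_image[OF q] by (simp add: rng_def)
  qed
  define k where "k = h (inv p)"
  note ip = permutes_inv[OF p(1)]
  note hm = h(1)[OF p(1), THEN stab_maps]
  have km: "k \<in> maps n"
    using h(1)[OF ip] stab_maps by (simp add: k_def)
  have fx: "(f \<star> h p) x = s (p (\<alpha> (f x)))" if "x \<in> {1..n}" for x
    using that f(1) by (simp add: star_apply h_def alpha_in maps_in alpha_alpha)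
  have pA: "p (\<alpha> (f x)) \<in> A" if "x \<in> {1..n}" for x
    using that alpha_maps_in_A[OF f(1)] permutes_in_image[OF p(1)] by blast
  \<comment> \<open>\<open>k\<close> undoes \<open>h p\<close> after \<open>f\<close> and lies on the same side as \<open>h p\<close>, which forces \<open>f \<star> h p\<close> to the side of \<open>f\<close>.\<close>
  have "f \<star> h p \<star> k = f"
  proof (rule maps_eqI)
    fix x assume x: "x \<in> {1..n}"
    have "(f \<star> h p \<star> k) x = s (inv p (p (\<alpha> (f x))))"
      using x pA[OF x] unfolding star_apply[OF x, of "f \<star> h p"] fx[OF x]
      by (simp add: k_def h_def s alpha_A A_in)
    then show "(f \<star> h p \<star> k) x = f x"
      using x sf permutes_inverses(2)[OF p(1)] by simp
  qed (use f hm km star_maps in auto)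
  moreover have "h p \<in> T \<longleftrightarrow> k \<in> T"
    unfolding k_def by (rule splits_cong[OF T]) (simp_all add: h p(1) ip)
  ultimately have hT: "f \<star> h p \<in> T \<longleftrightarrow> f \<in> T"
    using splitsD[OF T f(1) hm] splitsD[OF T star_maps[OF f(1) hm] km] by metis
  define g where "g = f \<star> h p \<star> f"
  show thesis
  proof
    show "g \<in> maps n"
      using f hm by (simp add: g_def star_maps)
    show "g \<notin> stab"
      using f hm by (simp add: g_def star_stab_iff star_maps)
    show "g \<in> T \<longleftrightarrow> f \<in> T"
      using splitsD[OF T star_maps[OF f(1) hm] f(1)] hT by (simp add: g_def)
    have "im n g = (\<lambda>b. f (p b)) ` B"
      unfolding im_def B_def image_image
      by (rule image_cong) (auto simp: g_def star_apply[of _ "f \<star> h p"] fx s pA)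
    moreover have "\<not> inj_on (\<lambda>b. f (p b)) B"
      using bb p faa by (metis inj_onD)
    ultimately have "card (im n g) \<noteq> card B"
      using \<open>finite B\<close> by (metis eq_card_imp_inj_on)
    moreover have "card (im n g) \<le> card B"
      using \<open>im n g = _\<close> \<open>finite B\<close> card_image_le by metis
    ultimately show "rank n g < rank n f"
      using cardB by (simp add: rank_def)
  qed
qed

text \<open>Induction on the rank. Passing to the idempotent power keeps the side and does not raise
  the rank; \<open>idempotent_reduce_rank\<close> lowers a rank above 1, and a map of smaller rank
  is constant.\<close>

lemma splits_nonstab_cst:
  assumes T: "splits T"
  shows "m \<in> maps n \<Longrightarrow> m \<notin> stab \<Longrightarrow> \<exists>z\<in>{1..n}. cst z \<in> T \<longleftrightarrow> m \<in> T"
proof (induction "rank n m" arbitrary: m rule: less_induct)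
  case less
  note m = less.prems
  obtain k where k: "is_idempotent (variant n \<alpha>) (power_Suc (variant n \<alpha>) m k)"
    using idempotent_power m(1) .
  define f where "f = power_Suc (variant n \<alpha>) m k"
  have f: "f \<in> maps n" "f \<notin> stab" "is_idempotent (variant n \<alpha>) f" "f \<in> T \<longleftrightarrow> m \<in> T"
    using m k by (simp_all add: f_def pow_closed power_stab_iff splits_power[OF T])
  have le: "rank n f \<le> rank n m"
    unfolding rank_def f_def by (intro card_mono im_power m) (simp add: im_def)
  show ?case
  proof (cases "rank n f > 1")
    case True
    obtain g where "g \<in> maps n" "g \<notin> stab" "g \<in> T \<longleftrightarrow> f \<in> T" "rank n g < rank n f"
      using idempotent_reduce_rank[OF T f(1-3) True] .
    then show ?thesis
      using less.hyps[of g] le f(4) by auto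
  next
    case False
    obtain a where a: "a \<in> {1..n}"
      using A_nonempty A_in by blast
    have "card (im n f) \<le> Suc 0" "finite (im n f)"
      using False by (simp_all add: rank_def im_def One_nat_def)
    then have "f x = f a" if "x \<in> {1..n}" for x
      using a that card_le_Suc0_iff_eq[of "im n f"] unfolding im_def by blast
    then have "f x = cst (f a) x" if "x \<in> {1..n}" for x
      using that unfolding cst_def by (metis restrict_apply')
    then have "f = cst (f a)"
      by (rule maps_eqI[OF f(1) cst_maps[OF maps_in[OF f(1) a]]])
    then show ?thesis
      using f a maps_in by metis
  qed
qed

lemma splits_nonstab:
  assumes "splits T" "\<beta> \<in> maps n - stab" "\<gamma> \<in> maps n - stab"
  shows "\<beta> \<in> T \<longleftrightarrow> \<gamma> \<in> T"
  using splits_nonstab_cst[OF assms(1)] splits_cst[OF assms(1)] assms(2,3) by (metis DiffE)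

section \<open>Classification of the completely isolated subsemigroups\<close>

lemma F_left: "F n \<alpha> X (YY n \<alpha>) = {\<beta> \<in> stab. ker \<beta> \<in> X}"
  by (auto simp: F_eq rng_in_YY)

lemma F_right: "F n \<alpha> (XX n \<alpha>) Y = {\<beta> \<in> stab. rng \<beta> \<in> Y}"
  by (auto simp: F_eq ker_in_XX)

text \<open>Besides showing that \<open>stab\<close> is non-empty, \<alpha> supplies a partition in
  \<open>XX n \<alpha>\<close> or a set in \<open>YY n \<alpha>\<close> when only the other
  invariant is prescribed.\<close>

lemma alpha_stab: "\<alpha> \<in> stab"
  using alpha_maps by (intro stabI_inj inj_onI) (auto simp: alpha_A)

text \<open>Stated for an arbitrary invariant \<open>k\<close>, to be used with \<open>ker\<close>
  and with \<open>rng\<close>. The index set is the set of values of \<open>k\<close> on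
  \<open>T\<close>; if these are all of \<open>K\<close>, then \<open>T\<close> is all of
  \<open>stab\<close>.\<close>

lemma subset_stab_cases:
  assumes "T \<subseteq> stab" and X: "\<forall>\<beta>\<in>stab. \<forall>\<gamma>\<in>stab. k \<beta> = k \<gamma> \<longrightarrow> (\<beta> \<in> T \<longleftrightarrow> \<gamma> \<in> T)"
    and K: "k ` stab \<subseteq> K"
  shows "T = {} \<or> T = stab \<or> (\<exists>X\<subseteq>K. X \<noteq> {} \<and> X \<noteq> K \<and> T = {\<beta> \<in> stab. k \<beta> \<in> X})"
proof -
  have eq: "T = {\<beta> \<in> stab. k \<beta> \<in> k ` T}"
  proof
    show "{\<beta> \<in> stab. k \<beta> \<in> k ` T} \<subseteq> T"
    proof clarify
      fix \<beta> \<gamma> assume "\<beta> \<in> stab" "k \<beta> = k \<gamma>" "\<gamma> \<in> T"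
      then show "\<beta> \<in> T"
        using X assms(1) by (metis subsetD)
    qed
  qed (use assms(1) in blast)
  have sub: "k ` T \<subseteq> K"
    using K assms(1) by (meson image_mono order_trans)
  show ?thesis
  proof (cases "k ` T = K")
    case True
    then have "T = stab"
      using eq K by (auto simp: image_subset_iff)
    then show ?thesis
      by simp
  next
    case False
    show ?thesis
    proof (cases "T = {}")
      case False
      with \<open>k ` T \<noteq> K\<close> show ?thesis
        using eq sub by (intro disjI2 exI[of _ "k ` T"]) simp
    qed simp
  qed
qed

text \<open>A product in \<open>stab\<close> has both factors in \<open>stab\<close> and the
  \<open>ker\<close> of the first, so it belongs to the set exactly when the first factor does; any
  other product has a factor outside \<open>stab\<close>.\<close>

lemma splits_left: "splits (F n \<alpha> X (YY n \<alpha>))"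
  unfolding splits_def F_left by (auto simp: star_stab_iff ker_star stab_maps)

lemma splits_right: "splits (F n \<alpha> (XX n \<alpha>) Y)"
  unfolding splits_def F_right by (auto simp: star_stab_iff rng_star stab_maps)

lemma splits_compl: "splits T \<Longrightarrow> splits (maps n - T)"
  unfolding splits_def by (auto simp: star_maps)

text \<open>This is the complement of the set with index \<open>- X\<close>. The index may leave
  \<open>XX n \<alpha>\<close>, as \<open>splits_left\<close> holds for every
  \<open>X\<close>.\<close>

lemma splits_left_compl: "splits (F n \<alpha> X (YY n \<alpha>) \<union> (maps n - stab))"
proof -
  have "F n \<alpha> X (YY n \<alpha>) \<union> (maps n - stab) = maps n - F n \<alpha> (- X) (YY n \<alpha>)"
    by (auto simp: F_left stab_maps)
  then show ?thesis
    using splits_compl splits_left by metis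
qed

lemma splits_right_compl: "splits (F n \<alpha> (XX n \<alpha>) Y \<union> (maps n - stab))"
proof -
  have "F n \<alpha> (XX n \<alpha>) Y \<union> (maps n - stab) = maps n - F n \<alpha> (XX n \<alpha>) (- Y)"
    by (auto simp: F_right stab_maps)
  then show ?thesis
    using splits_compl splits_right by metis
qed

lemma F_left_nonempty: "X \<subseteq> XX n \<alpha> \<Longrightarrow> X \<noteq> {} \<Longrightarrow> F n \<alpha> X (YY n \<alpha>) \<noteq> {}"
  using stab_exists[OF _ rng_in_YY[OF alpha_stab]] unfolding F_left by blast

lemma F_right_nonempty: "Y \<subseteq> YY n \<alpha> \<Longrightarrow> Y \<noteq> {} \<Longrightarrow> F n \<alpha> (XX n \<alpha>) Y \<noteq> {}"
  using stab_exists[OF ker_in_XX[OF alpha_stab]] unfolding F_right by blast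

lemma F_XX_YY: "F n \<alpha> (XX n \<alpha>) (YY n \<alpha>) = stab"
  by (auto simp: F_right rng_in_YY)

lemma nonstab_nonempty: "maps n - stab \<noteq> {}"
proof -
  obtain a where "a \<in> {1..n}"
    using A_nonempty A_in by blast
  then show ?thesis
    using cst_maps cst_not_stab by blast
qed

lemma splits_inter_nonstab:
  assumes "splits T"
  shows "T = T \<inter> stab \<or> T = (T \<inter> stab) \<union> (maps n - stab)"
proof -
  have "T \<subseteq> maps n"
    using assms by (simp add: splits_def)
  then show ?thesis
    using splits_nonstab[OF assms] by blast
qed

text \<open>The trace of \<open>T\<close> on \<open>stab\<close> is empty, full, or given by one of
  the two invariants; independently, \<open>T\<close> contains all or none of the elements outside
  \<open>stab\<close>.\<close>

lemma completely_isolated_eq: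
  "{T. completely_isolated (maps n) (variant n \<alpha>) T} =
      {maps n, stab, maps n - stab}
      \<union> ({F n \<alpha> X (YY n \<alpha>) | X. X \<subseteq> XX n \<alpha> \<and> X \<noteq> {} \<and> X \<noteq> XX n \<alpha>}
        \<union> {F n \<alpha> X (YY n \<alpha>) \<union> (maps n - stab) | X. X \<subseteq> XX n \<alpha> \<and> X \<noteq> {} \<and> X \<noteq> XX n \<alpha>})
      \<union> ({F n \<alpha> (XX n \<alpha>) Y | Y. Y \<subseteq> YY n \<alpha> \<and> Y \<noteq> {} \<and> Y \<noteq> YY n \<alpha>}
        \<union> {F n \<alpha> (XX n \<alpha>) Y \<union> (maps n - stab) | Y. Y \<subseteq> YY n \<alpha> \<and> Y \<noteq> {} \<and> Y \<noteq> YY n \<alpha>})"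
  (is "?L = ?R")
proof (intro equalityI subsetI)
  fix T assume "T \<in> ?L"
  then have T: "splits T" "T \<noteq> {}"
    by (simp_all add: completely_isolated_iff)
  have sub: "T \<inter> stab \<subseteq> stab"
    by simp
  consider (trivial) "T \<inter> stab = {} \<or> T \<inter> stab = stab"
    | (left) X where "X \<subseteq> XX n \<alpha> \<and> X \<noteq> {} \<and> X \<noteq> XX n \<alpha>" "T \<inter> stab = F n \<alpha> X (YY n \<alpha>)"
    | (right) Y where "Y \<subseteq> YY n \<alpha> \<and> Y \<noteq> {} \<and> Y \<noteq> YY n \<alpha>" "T \<inter> stab = F n \<alpha> (XX n \<alpha>) Y"
    using splits_stab_cases[OF T(1)]
  proof (rule disjE)
    assume "\<forall>\<beta>\<in>stab. \<forall>\<gamma>\<in>stab. ker \<beta> = ker \<gamma> \<longrightarrow> (\<beta> \<in> T \<longleftrightarrow> \<gamma> \<in> T)"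
    then have *: "\<forall>\<beta>\<in>stab. \<forall>\<gamma>\<in>stab. ker \<beta> = ker \<gamma> \<longrightarrow> (\<beta> \<in> T \<inter> stab \<longleftrightarrow> \<gamma> \<in> T \<inter> stab)"
      by blast
    have "ker ` stab \<subseteq> XX n \<alpha>"
      using ker_in_XX by (rule image_subsetI)
    from subset_stab_cases[OF sub * this] consider "T \<inter> stab = {} \<or> T \<inter> stab = stab"
      | X where "X \<subseteq> XX n \<alpha>" "X \<noteq> {}" "X \<noteq> XX n \<alpha>" "T \<inter> stab = {\<beta> \<in> stab. ker \<beta> \<in> X}"
      by metis
    then show thesis
    proof cases
      case 1
      then show ?thesis
        by (rule trivial)
    next
      case 2
      show ?thesis
        by (rule left[of X]) (use 2 in \<open>simp_all add: F_left\<close>)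
    qed
  next
    assume "\<forall>\<beta>\<in>stab. \<forall>\<gamma>\<in>stab. rng \<beta> = rng \<gamma> \<longrightarrow> (\<beta> \<in> T \<longleftrightarrow> \<gamma> \<in> T)"
    then have *: "\<forall>\<beta>\<in>stab. \<forall>\<gamma>\<in>stab. rng \<beta> = rng \<gamma> \<longrightarrow> (\<beta> \<in> T \<inter> stab \<longleftrightarrow> \<gamma> \<in> T \<inter> stab)"
      by blast
    have "rng ` stab \<subseteq> YY n \<alpha>"
      using rng_in_YY by (rule image_subsetI)
    from subset_stab_cases[OF sub * this] consider "T \<inter> stab = {} \<or> T \<inter> stab = stab"
      | X where "X \<subseteq> YY n \<alpha>" "X \<noteq> {}" "X \<noteq> YY n \<alpha>" "T \<inter> stab = {\<beta> \<in> stab. rng \<beta> \<in> X}"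
      by metis
    then show thesis
    proof cases
      case 1
      then show ?thesis
        by (rule trivial)
    next
      case 2
      show ?thesis
        by (rule right[of X]) (use 2 in \<open>simp_all add: F_right\<close>)
    qed
  qed
  then show "T \<in> ?R"
  proof cases
    case trivial
    moreover have "stab \<union> (maps n - stab) = maps n"
      using stab_maps by blast
    \<comment> \<open>An empty or full trace on \<open>stab\<close>, with or without the rest, gives
      four sets; the empty one is excluded.\<close>
    ultimately have "T \<in> {maps n, stab, maps n - stab}"
      using splits_inter_nonstab[OF T(1)] T(2) by auto
    then show ?thesis
      by blast
  next
    case left
    have "T = F n \<alpha> X (YY n \<alpha>) \<or> T = F n \<alpha> X (YY n \<alpha>) \<union> (maps n - stab)"
      using splits_inter_nonstab[OF T(1)] unfolding left(2) .
    then have "T \<in> {F n \<alpha> X (YY n \<alpha>) | X. X \<subseteq> XX n \<alpha> \<and> X \<noteq> {} \<and> X \<noteq> XX n \<alpha>} \<union> {F n \<alpha> X (YY n \<alpha>) \<union> (maps n - stab) | X. X \<subseteq> XX n \<alpha> \<and> X \<noteq> {} \<and> X \<noteq> XX n \<alpha>}"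
    proof
      assume "T = F n \<alpha> X (YY n \<alpha>)"
      with left(1) show ?thesis
        by (intro UnI1 CollectI exI[of _ X] conjI) blast+
    next
      assume "T = F n \<alpha> X (YY n \<alpha>) \<union> (maps n - stab)"
      with left(1) show ?thesis
        by (intro UnI2 CollectI exI[of _ X] conjI) blast+
    qed
    then show ?thesis
      by (rule UnI1[OF UnI2])
  next
    case right
    have "T = F n \<alpha> (XX n \<alpha>) Y \<or> T = F n \<alpha> (XX n \<alpha>) Y \<union> (maps n - stab)"
      using splits_inter_nonstab[OF T(1)] unfolding right(2) .
    then have "T \<in> {F n \<alpha> (XX n \<alpha>) Y | Y. Y \<subseteq> YY n \<alpha> \<and> Y \<noteq> {} \<and> Y \<noteq> YY n \<alpha>} \<union> {F n \<alpha> (XX n \<alpha>) Y \<union> (maps n - stab) | Y. Y \<subseteq> YY n \<alpha> \<and> Y \<noteq> {} \<and> Y \<noteq> YY n \<alpha>}"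
    proof
      assume "T = F n \<alpha> (XX n \<alpha>) Y"
      with right(1) show ?thesis
        by (intro UnI1 CollectI exI[of _ Y] conjI) blast+
    next
      assume "T = F n \<alpha> (XX n \<alpha>) Y \<union> (maps n - stab)"
      with right(1) show ?thesis
        by (intro UnI2 CollectI exI[of _ Y] conjI) blast+
    qed
    then show ?thesis
      by (rule UnI2)
  qed
next
  fix T assume T: "T \<in> ?R"
  then consider (trivial) "T \<in> {maps n, stab, maps n - stab}"
    | (left) X where "X \<subseteq> XX n \<alpha>" "X \<noteq> {}"
        "T = F n \<alpha> X (YY n \<alpha>) \<or> T = F n \<alpha> X (YY n \<alpha>) \<union> (maps n - stab)"
    | (right) Y where "Y \<subseteq> YY n \<alpha>" "Y \<noteq> {}"
        "T = F n \<alpha> (XX n \<alpha>) Y \<or> T = F n \<alpha> (XX n \<alpha>) Y \<union> (maps n - stab)"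
    by blast
  then have "splits T \<and> T \<noteq> {}"
  proof cases
    case trivial
    have "splits stab"
      using splits_left[of "XX n \<alpha>"] by (simp add: F_XX_YY)
    moreover have "splits (maps n)"
      by (simp add: splits_def star_maps)
    ultimately have "splits T"
      using trivial splits_compl by blast
    moreover have "T \<noteq> {}"
      using trivial nonstab_nonempty alpha_stab alpha_maps by blast
    ultimately show ?thesis ..
  next
    case left
    then show ?thesis
      using splits_left[of X] splits_left_compl[of X] F_left_nonempty[of X] by (metis Un_empty)
  next
    case right
    then show ?thesis
      using splits_right[of Y] splits_right_compl[of Y] F_right_nonempty[of Y] by (metis Un_empty)
  qed
  then show "T \<in> ?L"
    by (simp add: completely_isolated_iff)
qed

section \<open>One-sided convex and convex subsemigroups\<close>

lemma one_sided_convex_subset_stab: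
  assumes "splits T" "T \<noteq> maps n"
    and "(\<forall>\<beta>\<in>maps n. \<forall>\<gamma>\<in>maps n. \<beta> \<star> \<gamma> \<in> T \<longrightarrow> \<gamma> \<in> T) \<or> (\<forall>\<beta>\<in>maps n. \<forall>\<gamma>\<in>maps n. \<beta> \<star> \<gamma> \<in> T \<longrightarrow> \<beta> \<in> T)"
  shows "T \<subseteq> stab"
proof (rule ccontr)
  assume "\<not> T \<subseteq> stab"
  then obtain c where c: "c \<in> maps n - stab"
    using assms(1) by (auto simp: splits_def)
  have sub: "maps n - stab \<subseteq> T"
    using splits_inter_nonstab[OF assms(1)] \<open>\<not> T \<subseteq> stab\<close> by blast
  have "\<gamma> \<in> T" if "\<gamma> \<in> maps n" for \<gamma>
  proof -
    \<comment> \<open>The elements outside \<open>stab\<close> form an ideal contained in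
      \<open>T\<close>, so both products with c lie in \<open>T\<close>, and either kind of
      convexity yields \<gamma>.\<close>
    have "\<gamma> \<star> c \<in> T" "c \<star> \<gamma> \<in> T"
      using c that sub star_stab_iff star_maps by blast+
    then show ?thesis
      using assms(3) c that by blast
  qed
  then show False
    using assms(1,2) by (auto simp: splits_def)
qed

lemma right_convex_splits: "right_convex (maps n) (variant n \<alpha>) T \<Longrightarrow> splits T"
  unfolding right_convex_def subsemigroup_def splits_def by blast

lemma left_convex_splits: "left_convex (maps n) (variant n \<alpha>) T \<Longrightarrow> splits T"
  unfolding left_convex_def subsemigroup_def splits_def by blast

lemma right_convex_eq:
  "{T. right_convex (maps n) (variant n \<alpha>) T} =
    {maps n} \<union> {F n \<alpha> (XX n \<alpha>) Y | Y. Y \<subseteq> YY n \<alpha> \<and> Y \<noteq> {}}" (is "?L = ?R")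
proof (intro equalityI subsetI)
  fix T assume "T \<in> ?L"
  then have T: "right_convex (maps n) (variant n \<alpha>) T" "T \<noteq> {}"
    "\<forall>\<beta>\<in>maps n. \<forall>\<gamma>\<in>maps n. \<beta> \<star> \<gamma> \<in> T \<longrightarrow> \<gamma> \<in> T"
    unfolding mem_Collect_eq right_convex_def subsemigroup_def by blast+
  note spl = right_convex_splits[OF T(1)]
  show "T \<in> ?R"
  proof (cases "T = maps n")
    case False
    then have sub: "T \<subseteq> stab"
      using one_sided_convex_subset_stab[OF spl] T(3) by blast
    have "\<beta> \<in> T" if "\<beta> \<in> stab" "\<gamma> \<in> T" "rng \<beta> = rng \<gamma>" for \<beta> \<gamma>
    proof -
      have \<gamma>: "\<gamma> \<in> stab" and m: "\<beta> \<in> maps n" "\<gamma> \<in> maps n"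
        using that sub stab_maps by blast+
      \<comment> \<open>The product has the \<open>ker\<close> of \<gamma> and the
        \<open>rng\<close> of \<beta>, which is also that of \<gamma>. Right convexity then passes
        from the product to \<beta>, so membership depends on \<open>rng\<close> alone.\<close>
      have "\<gamma> \<star> \<beta> \<in> T \<longleftrightarrow> \<gamma> \<in> T"
        using that \<gamma> m by (intro splits_cong[OF spl]) (simp_all add: star_stab_iff ker_star rng_star)
      then show ?thesis
        using T(3) m that by blast
    qed
    then have "T = F n \<alpha> (XX n \<alpha>) (rng ` T)"
      unfolding F_right using sub by blast
    moreover have "rng ` T \<subseteq> YY n \<alpha>"
      using sub rng_in_YY by blast
    ultimately show ?thesis
      using T(2) by blast
  qed simp
next
  fix T assume "T \<in> ?R"
  then consider "T = maps n" | Y where "T = F n \<alpha> (XX n \<alpha>) Y" "Y \<subseteq> YY n \<alpha>" "Y \<noteq> {}"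
    by blast
  then show "T \<in> ?L"
  proof cases
    case 1
    then show ?thesis
      using alpha_maps by (auto simp: right_convex_def subsemigroup_def star_maps)
  next
    case 2
    then show ?thesis
      using F_right_nonempty[of Y]
      by (auto simp: F_right right_convex_def subsemigroup_def star_stab_iff rng_star stab_maps)
  qed
qed

lemma left_convex_eq:
  "{T. left_convex (maps n) (variant n \<alpha>) T} =
    {maps n} \<union> {F n \<alpha> X (YY n \<alpha>) | X. X \<subseteq> XX n \<alpha> \<and> X \<noteq> {}}" (is "?L = ?R")
proof (intro equalityI subsetI)
  fix T assume "T \<in> ?L"
  then have T: "left_convex (maps n) (variant n \<alpha>) T" "T \<noteq> {}"
    "\<forall>\<beta>\<in>maps n. \<forall>\<gamma>\<in>maps n. \<beta> \<star> \<gamma> \<in> T \<longrightarrow> \<beta> \<in> T"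
    unfolding mem_Collect_eq left_convex_def subsemigroup_def by blast+
  note spl = left_convex_splits[OF T(1)]
  show "T \<in> ?R"
  proof (cases "T = maps n")
    case False
    then have sub: "T \<subseteq> stab"
      using one_sided_convex_subset_stab[OF spl] T(3) by blast
    have "\<beta> \<in> T" if "\<beta> \<in> stab" "\<gamma> \<in> T" "ker \<beta> = ker \<gamma>" for \<beta> \<gamma>
    proof -
      have \<gamma>: "\<gamma> \<in> stab" and m: "\<beta> \<in> maps n" "\<gamma> \<in> maps n"
        using that sub stab_maps by blast+
      \<comment> \<open>Here \<beta> comes first: left convexity extracts the first factor, and the
        common invariant is \<open>ker\<close>.\<close>
      have "\<beta> \<star> \<gamma> \<in> T \<longleftrightarrow> \<gamma> \<in> T"
        using that \<gamma> m by (intro splits_cong[OF spl]) (simp_all add: star_stab_iff ker_star rng_star)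
      then show ?thesis
        using T(3) m that by blast
    qed
    then have "T = F n \<alpha> (ker ` T) (YY n \<alpha>)"
      unfolding F_left using sub by blast
    moreover have "ker ` T \<subseteq> XX n \<alpha>"
      using sub ker_in_XX by blast
    ultimately show ?thesis
      using T(2) by blast
  qed simp
next
  fix T assume "T \<in> ?R"
  then consider "T = maps n" | X where "T = F n \<alpha> X (YY n \<alpha>)" "X \<subseteq> XX n \<alpha>" "X \<noteq> {}"
    by blast
  then show "T \<in> ?L"
  proof cases
    case 1
    then show ?thesis
      using alpha_maps by (auto simp: left_convex_def subsemigroup_def star_maps)
  next
    case 2
    then show ?thesis
      using F_left_nonempty[of X]
      by (auto simp: F_left left_convex_def subsemigroup_def star_stab_iff ker_star stab_maps)
  qed
qed

text \<open>Left convexity makes membership depend on \<open>ker\<close> alone. Multiplying a member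
  on the right by any \<beta> in \<open>stab\<close> keeps its \<open>ker\<close>, and right
  convexity then extracts \<beta>.\<close>

lemma convex_subsemigroup_eq:
  "{T. convex_subsemigroup (maps n) (variant n \<alpha>) T} = {maps n, stab}" (is "?L = ?R")
proof (intro equalityI subsetI)
  fix T assume "T \<in> ?L"
  then have T: "right_convex (maps n) (variant n \<alpha>) T" "left_convex (maps n) (variant n \<alpha>) T"
    by (auto simp: convex_subsemigroup_def right_convex_def left_convex_def)
  show "T \<in> ?R"
  proof (cases "T = maps n")
    case False
    then obtain X where X: "X \<noteq> {}" "T = F n \<alpha> X (YY n \<alpha>)"
      using T(2) left_convex_eq by blast
    have sub: "T \<subseteq> stab" and "T \<noteq> {}"
      using X T by (auto simp: F_left left_convex_def subsemigroup_def)
    then obtain \<gamma> where \<gamma>: "\<gamma> \<in> stab" "\<gamma> \<in> T"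
      by blast
    have "\<beta> \<in> T" if "\<beta> \<in> stab" for \<beta>
    proof -
      have "\<gamma> \<star> \<beta> \<in> T"
        using that \<gamma> by (simp add: X(2) F_left star_stab_iff ker_star stab_maps)
      then show ?thesis
        using T(1) that \<gamma> stab_maps unfolding right_convex_def by blast
    qed
    then show ?thesis
      using sub by blast
  qed simp
next
  fix T assume "T \<in> ?R"
  then show "T \<in> ?L"
    using alpha_stab alpha_maps stab_maps
    by (auto simp: convex_subsemigroup_def subsemigroup_def star_maps star_stab_iff)
qed

end

theorem theorem30:
  fixes n l :: nat and \<alpha> :: "nat \<Rightarrow> nat"
  assumes "n \<ge> 1"
    and "\<alpha> \<in> maps n"
    and "is_idempotent (comp_lr n) \<alpha>"
    and "rank n \<alpha> = l"
    and "l > 2"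
  shows "({T. completely_isolated (maps n) (variant n \<alpha>) T} =
      {maps n, stable_maps n \<alpha> l, maps n - stable_maps n \<alpha> l}
      \<union> ({F n \<alpha> X (YY n \<alpha>) | X. X \<subseteq> XX n \<alpha> \<and> X \<noteq> {} \<and> X \<noteq> XX n \<alpha>}
        \<union> {F n \<alpha> X (YY n \<alpha>) \<union> (maps n - stable_maps n \<alpha> l) | X.
            X \<subseteq> XX n \<alpha> \<and> X \<noteq> {} \<and> X \<noteq> XX n \<alpha>})
      \<union> ({F n \<alpha> (XX n \<alpha>) Y | Y. Y \<subseteq> YY n \<alpha> \<and> Y \<noteq> {} \<and> Y \<noteq> YY n \<alpha>}
        \<union> {F n \<alpha> (XX n \<alpha>) Y \<union> (maps n - stable_maps n \<alpha> l) | Y.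
            Y \<subseteq> YY n \<alpha> \<and> Y \<noteq> {} \<and> Y \<noteq> YY n \<alpha>}))
    \<and> ({T. right_convex (maps n) (variant n \<alpha>) T} =
      {maps n} \<union> {F n \<alpha> (XX n \<alpha>) Y | Y. Y \<subseteq> YY n \<alpha> \<and> Y \<noteq> {}})
    \<and> ({T. left_convex (maps n) (variant n \<alpha>) T} =
      {maps n} \<union> {F n \<alpha> X (YY n \<alpha>) | X. X \<subseteq> XX n \<alpha> \<and> X \<noteq> {}})
    \<and> ({T. convex_subsemigroup (maps n) (variant n \<alpha>) T} =
      {maps n, stable_maps n \<alpha> l})"
proof -
  interpret idempotent_variant n \<alpha>
    using assms by unfold_locales auto
  have "stable_maps n \<alpha> l = stab"
    using stable_maps_eq assms(4) by simp
  then show ?thesis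
    using completely_isolated_eq right_convex_eq left_convex_eq convex_subsemigroup_eq by simp
qed

end
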